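(* Let $n \geq 5$ and let $G$ be a non-cyclic quotient of the braid group $B_n$. Then $$|G| \geq 3^{\lfloor n/2 \rfloor - 1}\,\lfloor n/2 \rfloor !$$
   Context: $B_n$ is the braid group on $n$ strands, with standard generators $\sigma_1,\dots,\sigma_{n-1}$ and relations $\sigma_i\sigma_j=\sigma_j\sigma_i$ for $|i-j|\ge 2$ and $\sigma_i\sigma_{i+1}\sigma_i=\sigma_{i+1}\sigma_i\sigma_{i+1}$. Its abelianization $B_n/B_n'$ is infinite cyclic. A homomorphism $B_n\to G$ is called cyclic if it factors through the abelianization $B_n \to B_n/B_n'\cong\mathbb{Z}$, and non-cyclic otherwise. A non-cyclic quotient of $B_n$ is a group $G$ for which there is a surjective non-cyclic homomorphism $B_n\to G$. If $G$ is infinite, the inequality is understood to hold. *)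

theory Defs
  imports "HOL-Algebra.Generated_Groups"
begin

text \<open>
  Groups given by generators and relations. A word is a list of letters; the letter
  \<open>(x, True)\<close> stands for the generator \<open>x\<close> and \<open>(x, False)\<close> for its inverse. A relation
  \<open>(u, v)\<close> stands for the equation \<open>u = v\<close>. The presented group is the set of words over \<open>X\<close>
  modulo the congruence generated by free cancellation and the relations in \<open>R\<close>.
\<close>

type_synonym 'x word = "('x \<times> bool) list"

definition words :: "'x set \<Rightarrow> 'x word set" where
  "words X = lists (X \<times> UNIV)"

inductive_set pres_rel :: "'x set \<Rightarrow> ('x word \<times> 'x word) set \<Rightarrow> ('x word \<times> 'x word) set"
  for X :: "'x set" and R :: "('x word \<times> 'x word) set" where
  refl: "u \<in> words X \<Longrightarrow> (u, u) \<in> pres_rel X R"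
| sym: "(u, v) \<in> pres_rel X R \<Longrightarrow> (v, u) \<in> pres_rel X R"
| trans: "(u, v) \<in> pres_rel X R \<Longrightarrow> (v, w) \<in> pres_rel X R \<Longrightarrow> (u, w) \<in> pres_rel X R"
| append: "(u, u') \<in> pres_rel X R \<Longrightarrow> (v, v') \<in> pres_rel X R \<Longrightarrow> (u @ v, u' @ v') \<in> pres_rel X R"
| cancel: "x \<in> X \<Longrightarrow> ([(x, b), (x, \<not> b)], []) \<in> pres_rel X R"
| relation: "(u, v) \<in> R \<Longrightarrow> u \<in> words X \<Longrightarrow> v \<in> words X \<Longrightarrow> (u, v) \<in> pres_rel X R"

definition presented_group :: "'x set \<Rightarrow> ('x word \<times> 'x word) set \<Rightarrow> 'x word set monoid" where
  "presented_group X R =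
     \<lparr>carrier = words X // pres_rel X R,
      mult = (\<lambda>A B. \<Union>u\<in>A. \<Union>v\<in>B. pres_rel X R `` {u @ v}),
      one = pres_rel X R `` {[]}\<rparr>"

lemma pres_rel_words:
  "(u, v) \<in> pres_rel X R \<Longrightarrow> u \<in> words X \<and> v \<in> words X"
  by (induction rule: pres_rel.induct) (auto simp: words_def)

lemma equiv_pres_rel: "equiv (words X) (pres_rel X R)"
  by (rule equivI)
    (auto simp: refl_on_def sym_def trans_def dest: pres_rel_words
      intro: pres_rel.refl pres_rel.sym pres_rel.trans)

lemma presented_group_mult:
  assumes "u \<in> words X" "v \<in> words X"
  shows "(pres_rel X R `` {u}) \<otimes>\<^bsub>presented_group X R\<^esub> (pres_rel X R `` {v}) = pres_rel X R `` {u @ v}"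
proof -
  have "congruent2 (pres_rel X R) (pres_rel X R) (\<lambda>u v. pres_rel X R `` {u @ v})"
    by (rule congruent2I')
      (auto intro!: equiv_class_eq[OF equiv_pres_rel] pres_rel.append)
  from UN_equiv_class2[OF equiv_pres_rel equiv_pres_rel this assms]
  show ?thesis by (simp add: presented_group_def)
qed

lemma group_presented_group: "group (presented_group X R)"
proof (rule groupI)
  fix A assume "A \<in> carrier (presented_group X R)"
  then obtain u where u: "u \<in> words X" and A: "A = pres_rel X R `` {u}"
    by (auto simp: presented_group_def elim: quotientE)
  have "\<exists>w\<in>words X. (w @ u, []) \<in> pres_rel X R"
    using u
  proof (induction u)
    case Nil
    have "[] \<in> words X" by (simp add: words_def)
    then show ?case by (auto intro: pres_rel.refl)
  next
    case (Cons a u)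
    obtain x b where a: "a = (x, b)" by fastforce
    from Cons obtain w where w: "w \<in> words X" and wu: "(w @ u, []) \<in> pres_rel X R"
      and x: "x \<in> X" and u: "u \<in> words X" by (auto simp: words_def a)
    have "([(x, \<not> b), (x, b)], []) \<in> pres_rel X R"
      using pres_rel.cancel[OF x, of "\<not> b"] by simp
    then have "(w @ ([(x, \<not> b), (x, b)] @ u), w @ ([] @ u)) \<in> pres_rel X R"
      by (intro pres_rel.append pres_rel.refl w u)
    then have "((w @ [(x, \<not> b)]) @ a # u, []) \<in> pres_rel X R"
      using wu by (auto simp: a intro: pres_rel.trans)
    moreover have "w @ [(x, \<not> b)] \<in> words X" using w x by (simp add: words_def)
    ultimately show ?case by blast
  qed
  then obtain w where w: "w \<in> words X" "(w @ u, []) \<in> pres_rel X R" by blast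
  show "\<exists>B\<in>carrier (presented_group X R). B \<otimes>\<^bsub>presented_group X R\<^esub> A = \<one>\<^bsub>presented_group X R\<^esub>"
  proof (rule bexI)
    show "(pres_rel X R `` {w}) \<otimes>\<^bsub>presented_group X R\<^esub> A = \<one>\<^bsub>presented_group X R\<^esub>"
      using equiv_class_eq[OF equiv_pres_rel w(2)]
      unfolding A presented_group_mult[OF w(1) u] by (simp add: presented_group_def)
    show "pres_rel X R `` {w} \<in> carrier (presented_group X R)"
      using w by (simp add: presented_group_def quotientI)
  qed
next
  fix A B assume "A \<in> carrier (presented_group X R)" "B \<in> carrier (presented_group X R)"
  then obtain u v where "u \<in> words X" "A = pres_rel X R `` {u}" "v \<in> words X" "B = pres_rel X R `` {v}"
    by (auto simp: presented_group_def elim!: quotientE)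
  then show "A \<otimes>\<^bsub>presented_group X R\<^esub> B \<in> carrier (presented_group X R)"
    by (simp add: presented_group_mult) (simp add: presented_group_def quotientI words_def)
next
  fix A B C assume "A \<in> carrier (presented_group X R)" "B \<in> carrier (presented_group X R)"
    "C \<in> carrier (presented_group X R)"
  then obtain u v w where "u \<in> words X" "A = pres_rel X R `` {u}"
    "v \<in> words X" "B = pres_rel X R `` {v}" "w \<in> words X" "C = pres_rel X R `` {w}"
    by (auto simp: presented_group_def elim!: quotientE)
  moreover from this have "u @ v \<in> words X" "v @ w \<in> words X" by (auto simp: words_def)
  ultimately show "A \<otimes>\<^bsub>presented_group X R\<^esub> B \<otimes>\<^bsub>presented_group X R\<^esub> C
      = A \<otimes>\<^bsub>presented_group X R\<^esub> (B \<otimes>\<^bsub>presented_group X R\<^esub> C)"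
    by (simp add: presented_group_mult)
next
  have nil: "[] \<in> words X" by (simp add: words_def)
  then show "\<one>\<^bsub>presented_group X R\<^esub> \<in> carrier (presented_group X R)"
    by (simp add: presented_group_def quotientI)
  fix A assume "A \<in> carrier (presented_group X R)"
  then obtain u where u: "u \<in> words X" "A = pres_rel X R `` {u}"
    by (auto simp: presented_group_def elim: quotientE)
  have "\<one>\<^bsub>presented_group X R\<^esub> = pres_rel X R `` {[]}" by (simp add: presented_group_def)
  then show "\<one>\<^bsub>presented_group X R\<^esub> \<otimes>\<^bsub>presented_group X R\<^esub> A = A"
    using presented_group_mult[OF nil u(1), of R] u(2) by simp
qed

text \<open>The braid group on \<open>n\<close> strands; the generator \<open>\<sigma>\<^sub>i\<close> is the letter \<open>(i, True)\<close>.\<close>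

definition braid_relations :: "nat \<Rightarrow> (nat word \<times> nat word) set" where
  "braid_relations n =
     {([(i, True), (j, True)], [(j, True), (i, True)]) | i j.
        i \<in> {1..<n} \<and> j \<in> {1..<n} \<and> \<bar>int i - int j\<bar> \<ge> 2} \<union>
     {([(i, True), (i + 1, True), (i, True)], [(i + 1, True), (i, True), (i + 1, True)]) | i.
        i \<in> {1..<n} \<and> i + 1 \<in> {1..<n}}"

definition braid_group :: "nat \<Rightarrow> nat word set monoid" where
  "braid_group n = presented_group {1..<n} (braid_relations n)"

lemma group_braid_group: "group (braid_group n)"
  unfolding braid_group_def by (rule group_presented_group)

definition abelianization :: "('a, 'm) monoid_scheme \<Rightarrow> 'a set monoid" where
  "abelianization H = H Mod derived H (carrier H)"

definition factors_through_abelianization ::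
  "('a, 'm) monoid_scheme \<Rightarrow> ('g, 'k) monoid_scheme \<Rightarrow> ('a \<Rightarrow> 'g) \<Rightarrow> bool" where
  "factors_through_abelianization H G f \<longleftrightarrow>
     (\<exists>h \<in> hom (abelianization H) G. \<forall>x \<in> carrier H. f x = h (derived H (carrier H) #>\<^bsub>H\<^esub> x))"

definition cyclic_braid_hom :: "nat \<Rightarrow> ('g, 'k) monoid_scheme \<Rightarrow> (nat word set \<Rightarrow> 'g) \<Rightarrow> bool" where
  "cyclic_braid_hom n G f \<longleftrightarrow>
     f \<in> hom (braid_group n) G \<and> factors_through_abelianization (braid_group n) G f"

definition noncyclic_braid_quotient :: "nat \<Rightarrow> ('g, 'k) monoid_scheme \<Rightarrow> bool" where
  "noncyclic_braid_quotient n G \<longleftrightarrow>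
     group G \<and> (\<exists>f \<in> epi (braid_group n) G. \<not> cyclic_braid_hom n G f)"

end

theory Submission
  imports Defs "HOL-Combinatorics.Permutations"
begin

text \<open>
  Let \<open>s\<^sub>1, \<dots>, s\<^sub>n\<^sub>-\<^sub>1\<close> be the images of the standard generators in the finite group \<open>G\<close>, and
  let \<open>k = \<lfloor>n/2\<rfloor>\<close>. The bound comes from families of elements of \<open>G\<close> whose members can be permuted
  arbitrarily by conjugation, the totally symmetric sets of Kordek and Margalit. If the \<open>k\<close> members
  of such a family are distinct and \<open>C\<close> centralizes all of them, then multiplying, for every
  permutation, one element that realises it by the elements of \<open>C\<close> gives \<open>k! |C|\<close> distinct elements
  of \<open>G\<close> (\<open>symmetric_family_card\<close>).

  The commuting elements \<open>s\<^sub>1, s\<^sub>3, s\<^sub>5, \<dots>\<close> form such a family of size \<open>k\<close>. If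
  \<open>s\<^sub>1 \<noteq> s\<^sub>3\<close> and \<open>s\<^sub>1\<^sup>2 \<noteq> s\<^sub>3\<^sup>2\<close>, then products of the first \<open>k - 1\<close> of
  them with exponents \<open>0, 1, 2\<close> are pairwise distinct: if two of them agreed, moving one factor to
  the spare \<open>k\<close>-th place would identify the first or second powers of two members
  (\<open>card_power_products\<close>). These products may serve as \<open>C\<close>, so
  \<open>|G| \<ge> 3\<^sup>k\<^sup>-\<^sup>1 k!\<close>.

  If \<open>s\<^sub>1\<^sup>2 = s\<^sub>3\<^sup>2\<close>, then, for \<open>n \<ge> 5\<close>, this square commutes with all generators and is
  the square of each of them (\<open>squares_central\<close>). Modulo a central element \<open>G\<close> then looks like a
  symmetric group, and the elements of \<open>G\<close> that lie over the transpositions \<open>(1 i)\<close> form a symmetric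
  family of size \<open>n - 1\<close> (\<open>star_symmetric\<close>). Hence \<open>|G| \<ge> (n - 1)!\<close>, which is at least
  \<open>3\<^sup>k\<^sup>-\<^sup>1 k!\<close>, because \<open>n - 1 \<ge> 2k - 1\<close> and each of \<open>k + 1, \<dots>, 2k - 1\<close> is at least \<open>3\<close>.

  In both cases the distinctness that is needed can only fail when two neighbouring generators have
  the same image. Then all of them do, \<open>G\<close> is abelian, and the homomorphism is cyclic
  (\<open>first_eq_if_skip_eq\<close>, \<open>all_eq_if_first_eq\<close>, \<open>cyclic_if_gens_eq\<close>).
\<close>

section \<open>Conjugation as a relation\<close>

context group
begin

text \<open>
  The equation \<open>g a g\<inverse> = b\<close>, written without an inverse so that relations between
  generators are literally statements of this form.
\<close>

definition conjugates :: "'a \<Rightarrow> 'a \<Rightarrow> 'a \<Rightarrow> bool" where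
  "conjugates g a b \<longleftrightarrow>
     g \<in> carrier G \<and> a \<in> carrier G \<and> b \<in> carrier G \<and> g \<otimes> a = b \<otimes> g"

lemma conjugates_carrier:
  assumes "conjugates g a b"
  shows "g \<in> carrier G" "a \<in> carrier G" "b \<in> carrier G"
  using assms by (auto simp: conjugates_def)

lemma conjugates_comp:
  assumes "conjugates h b c" "conjugates g a b"
  shows "conjugates (h \<otimes> g) a c"
  using assms unfolding conjugates_def by (metis m_assoc m_closed)

lemma conjugates_mult:
  assumes "conjugates g a b" "conjugates g c d"
  shows "conjugates g (a \<otimes> c) (b \<otimes> d)"
  using assms unfolding conjugates_def by (metis m_assoc m_closed)

lemma conjugates_one: "g \<in> carrier G \<Longrightarrow> conjugates g \<one> \<one>"
  by (simp add: conjugates_def)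

lemma conjugates_pow:
  fixes d :: nat
  assumes "conjugates g a b"
  shows "conjugates g (a [^] d) (b [^] d)"
  by (induction d) (use assms conjugates_carrier(1)[OF assms] in
    \<open>auto intro: conjugates_mult conjugates_one\<close>)

lemma conjugates_inv: "conjugates g a b \<Longrightarrow> conjugates (inv g) b a"
  unfolding conjugates_def
  by (metis inv_closed inv_solve_left inv_solve_right m_assoc m_closed)

lemma conjugates_right_unique: "conjugates g a b \<Longrightarrow> conjugates g a c \<Longrightarrow> b = c"
  unfolding conjugates_def by (metis right_cancel)

text \<open>
  Two words that take \<open>a\<close> to known places, one a suffix of the other, reveal how the remaining
  prefix acts; the braid relation supplies such pairs of words.
\<close>

lemma conjugates_left_factor:
  assumes "conjugates p a b" "conjugates (h \<otimes> p) a c" "h \<in> carrier G"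
  shows "conjugates h b c"
  using assms unfolding conjugates_def by (metis m_assoc m_closed right_cancel)

lemma commutes_sym: "conjugates g a a \<Longrightarrow> conjugates a g g"
  by (simp add: conjugates_def)

lemma commutes_refl: "a \<in> carrier G \<Longrightarrow> conjugates a a a"
  by (simp add: conjugates_def)

lemma conjugates_fixed_inv: "conjugates g a a \<Longrightarrow> conjugates g (inv a) (inv a)"
  by (intro commutes_sym[OF conjugates_inv[OF commutes_sym]])

section \<open>Symmetric families\<close>

text \<open>
  The family is indexed by an initial segment of the naturals, and repetitions are allowed. In this
  form the images of a symmetric family under a homomorphism are again one, with distinctness left
  as a separate question; \<open>symmetric_family_inj_on\<close> shows that the members are either pairwise
  distinct or all equal.
\<close>

definition symmetric_family :: "nat \<Rightarrow> (nat \<Rightarrow> 'a) \<Rightarrow> bool" where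
  "symmetric_family k x \<longleftrightarrow>
     (\<forall>\<pi>. \<pi> permutes {..<k} \<longrightarrow>
        (\<exists>g \<in> carrier G. \<forall>i<k. conjugates g (x i) (x (\<pi> i))))"

lemma symmetric_family_carrier:
  assumes "symmetric_family k x" "i < k"
  shows "x i \<in> carrier G"
  using assms permutes_id[of "{..<k}"] conjugates_carrier(2)
  unfolding symmetric_family_def by blast

lemma symmetric_family_swap:
  assumes "symmetric_family k x" "i < k" "j < k"
  obtains g where "g \<in> carrier G"
    and "\<And>l. l < k \<Longrightarrow> conjugates g (x l) (x (Transposition.transpose i j l))"
proof -
  have "Transposition.transpose i j permutes {..<k}"
    using assms by (intro permutes_swap_id) auto
  with assms(1) that show thesis unfolding symmetric_family_def by blast
qed

text \<open>
  The permutations realised by conjugation are closed under composition, and neighbouring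
  transpositions generate all permutations.
\<close>

lemma symmetric_familyI:
  assumes x: "\<And>i. i < k \<Longrightarrow> x i \<in> carrier G"
    and swap: "\<And>i. Suc i < k \<Longrightarrow> \<exists>g \<in> carrier G. \<forall>l<k.
      conjugates g (x l) (x (Transposition.transpose i (Suc i) l))"
  shows "symmetric_family k x"
proof -
  define realised where "realised \<pi> \<longleftrightarrow> (\<exists>g \<in> carrier G. \<forall>l<k. conjugates g (x l) (x (\<pi> l)))"
    for \<pi>
  have comp: "realised (\<pi> \<circ> \<rho>)" if "realised \<pi>" "realised \<rho>" "\<rho> permutes {..<k}" for \<pi> \<rho>
  proof -
    obtain g h where g: "g \<in> carrier G" "\<And>l. l < k \<Longrightarrow> conjugates g (x l) (x (\<pi> l))"
      and h: "h \<in> carrier G" "\<And>l. l < k \<Longrightarrow> conjugates h (x l) (x (\<rho> l))"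
      using \<open>realised \<pi>\<close> \<open>realised \<rho>\<close> unfolding realised_def by blast
    have "conjugates (g \<otimes> h) (x l) (x ((\<pi> \<circ> \<rho>) l))" if "l < k" for l
    proof -
      have "\<rho> l < k"
        using permutes_in_image[OF \<open>\<rho> permutes {..<k}\<close>, of l] that by simp
      then show ?thesis using conjugates_comp[OF g(2) h(2)] that by simp
    qed
    then show ?thesis unfolding realised_def using g(1) h(1) by (intro bexI[of _ "g \<otimes> h"]) simp_all
  qed
  have adjacent: "realised (Transposition.transpose i (Suc i))" if "Suc i < k" for i
    unfolding realised_def by (rule swap[OF that])
  have transposition: "realised (Transposition.transpose i (i + Suc d))" if "i + Suc d < k" for i d
    using that
  proof (induction d)
    case 0
    then show ?case using adjacent[of i] by simp
  next
    case (Suc d)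
    let ?a = "Transposition.transpose (i + Suc (Suc d)) (i + Suc d)"
    let ?b = "Transposition.transpose (i + Suc d) i"
    have perm: "?a permutes {..<k}" "?b permutes {..<k}"
      using Suc.prems by (auto intro!: permutes_swap_id)
    have a: "realised ?a"
      using adjacent[of "i + Suc d"] Suc.prems by (simp add: transpose_commute)
    have b: "realised ?b"
      using Suc by (simp add: transpose_commute)
    \<comment> \<open>A transposition over distance \<open>d + 2\<close> is one over distance \<open>d + 1\<close> conjugated by a neighbouring one.\<close>
    have "realised (?a \<circ> ?b \<circ> ?a)"
      by (rule comp[OF comp[OF a b perm(2)] a perm(1)])
    moreover have "?a \<circ> ?b \<circ> ?a = Transposition.transpose i (i + Suc (Suc d))"
      by (subst transpose_comp_triple) (auto simp: transpose_commute)
    ultimately show ?case by (simp only:)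
  qed
  have any_transposition: "realised (Transposition.transpose i j)"
    if "i < k" "j < k" "i \<noteq> j" for i j
  proof (cases "i < j")
    case True
    then show ?thesis using transposition[of i "j - i - 1"] that by simp
  next
    case False
    then show ?thesis using transposition[of j "i - j - 1"] that by (simp add: transpose_commute)
  qed
  have "realised \<pi>" if "\<pi> permutes {..<k}" for \<pi>
    using that finite_lessThan
  proof (induction rule: permutes_induct)
    case id
    show ?case unfolding realised_def using x by (auto intro!: bexI[of _ \<one>] simp: conjugates_def)
  next
    case (swap a b p)
    then show ?case by (intro comp any_transposition) simp_all
  qed
  then show ?thesis by (simp add: symmetric_family_def realised_def)
qed

text \<open>
  A coincidence between the members at \<open>i\<close> and \<open>j\<close> is carried by the transposition of \<open>j\<close> and \<open>l\<close> to
  one between those at \<open>i\<close> and \<open>l\<close>, so a single coincidence forces all of them.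
\<close>

lemma symmetric_family_pow_eq:
  fixes d :: nat
  assumes x: "symmetric_family k x" and "i < k" "j < k" "i \<noteq> j" and eq: "x i [^] d = x j [^] d"
    and "a < k" "b < k"
  shows "x a [^] d = x b [^] d"
proof -
  have "x l [^] d = x i [^] d" if l: "l < k" for l
  proof (cases "l = i")
    case False
    obtain g where g: "g \<in> carrier G"
      "\<And>l'. l' < k \<Longrightarrow> conjugates g (x l') (x (Transposition.transpose j l l'))"
      using symmetric_family_swap[OF x \<open>j < k\<close> l] by blast
    have "conjugates g (x i [^] d) (x i [^] d)"
      using conjugates_pow[OF g(2)[OF \<open>i < k\<close>]] False \<open>i \<noteq> j\<close> by (simp add: transpose_def)
    moreover have "conjugates g (x j [^] d) (x l [^] d)"
      using conjugates_pow[OF g(2)[OF \<open>j < k\<close>]] by simp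
    ultimately show ?thesis using eq conjugates_right_unique by simp
  qed simp
  from this[OF \<open>a < k\<close>] this[OF \<open>b < k\<close>] show ?thesis by simp
qed

lemma symmetric_family_inj_on:
  assumes x: "symmetric_family k x" and "i < k" "j < k" "x i \<noteq> x j"
  shows "inj_on x {..<k}"
proof (rule inj_onI, rule ccontr)
  fix a b assume ab: "a \<in> {..<k}" "b \<in> {..<k}" "x a = x b" "a \<noteq> b"
  have "x i [^] (1::nat) = x j [^] (1::nat)"
    using symmetric_family_pow_eq[OF x _ _ ab(4), of 1 i j] ab assms by simp
  then show False using assms symmetric_family_carrier[OF x] by simp
qed

text \<open>
  Choose \<open>\<gamma> \<pi>\<close> realising \<open>\<pi>\<close>. The product \<open>\<gamma> \<pi> c\<close> acts on the family as \<open>\<pi>\<close>, so it determines \<open>\<pi>\<close>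
  because the members are distinct, and then it determines \<open>c\<close>.
\<close>

lemma symmetric_family_card:
  assumes x: "symmetric_family k x" and inj: "inj_on x {..<k}" and fin: "finite (carrier G)"
    and C: "\<And>c. c \<in> C \<Longrightarrow> c \<in> carrier G"
      "\<And>c i. c \<in> C \<Longrightarrow> i < k \<Longrightarrow> conjugates c (x i) (x i)"
  shows "fact k * card C \<le> order G"
proof -
  let ?P = "{\<pi>. \<pi> permutes {..<k}}"
  obtain \<gamma> where \<gamma>: "\<And>\<pi>. \<pi> permutes {..<k} \<Longrightarrow> \<gamma> \<pi> \<in> carrier G"
    "\<And>\<pi> i. \<pi> permutes {..<k} \<Longrightarrow> i < k \<Longrightarrow> conjugates (\<gamma> \<pi>) (x i) (x (\<pi> i))"
    using x unfolding symmetric_family_def by metis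
  have "inj_on (\<lambda>(\<pi>, c). \<gamma> \<pi> \<otimes> c) (?P \<times> C)"
  proof (rule inj_onI, clarify)
    fix \<pi> \<rho> c d
    assume \<pi>: "\<pi> permutes {..<k}" and \<rho>: "\<rho> permutes {..<k}" and cd: "c \<in> C" "d \<in> C"
      and eq: "\<gamma> \<pi> \<otimes> c = \<gamma> \<rho> \<otimes> d"
    have "\<pi> i = \<rho> i" if i: "i < k" for i
    proof -
      have "conjugates (\<gamma> \<pi> \<otimes> c) (x i) (x (\<pi> i))" "conjugates (\<gamma> \<rho> \<otimes> d) (x i) (x (\<rho> i))"
        using conjugates_comp \<gamma>(2) C(2) \<pi> \<rho> cd i by blast+
      then have "x (\<pi> i) = x (\<rho> i)" using eq conjugates_right_unique by simp
      moreover have "\<pi> i < k" "\<rho> i < k"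
        using permutes_in_image[OF \<pi>, of i] permutes_in_image[OF \<rho>, of i] i by auto
      ultimately show ?thesis using inj by (auto dest: inj_onD)
    qed
    moreover have "\<pi> i = \<rho> i" if "\<not> i < k" for i
      using permutes_not_in[OF \<pi>, of i] permutes_not_in[OF \<rho>, of i] that by simp
    ultimately have "\<pi> = \<rho>" by blast
    then show "\<pi> = \<rho> \<and> c = d" using eq cd C(1) \<gamma>(1)[OF \<rho>] by simp
  qed
  moreover have "(\<lambda>(\<pi>, c). \<gamma> \<pi> \<otimes> c) ` (?P \<times> C) \<subseteq> carrier G"
    using \<gamma>(1) C(1) by auto
  ultimately have "card (?P \<times> C) \<le> card (carrier G)"
    using card_inj_on_le fin by blast
  then show ?thesis by (simp add: card_cartesian_product card_permutations order_def)
qed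

text \<open>
  The exponents stop at \<open>2\<close> because comparing two such products leads only to the first and second
  powers of the members, which is where coincidences are excluded.
\<close>

primrec power_products :: "(nat \<Rightarrow> 'a) \<Rightarrow> nat \<Rightarrow> 'a set" where
  "power_products x 0 = {\<one>}"
| "power_products x (Suc j) = (\<lambda>(a::nat, h). x j [^] a \<otimes> h) ` ({..<3} \<times> power_products x j)"

lemma power_products_fixed:
  assumes "g \<in> carrier G" "\<And>i. i < j \<Longrightarrow> conjugates g (x i) (x i)" "h \<in> power_products x j"
  shows "conjugates g h h"
  using assms(2,3)
proof (induction j arbitrary: h)
  case 0
  then show ?case using assms(1) by (simp add: conjugates_one)
next
  case (Suc j)
  obtain a :: nat and h' where h: "h = x j [^] a \<otimes> h'" and h': "h' \<in> power_products x j"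
    using Suc.prems(2) by auto
  have "conjugates g h' h'" by (rule Suc.IH[OF Suc.prems(1) h']) simp
  then show ?case unfolding h by (intro conjugates_mult conjugates_pow Suc.prems(1)) simp
qed

lemma power_products_carrier:
  assumes "\<And>i. i < j \<Longrightarrow> x i \<in> carrier G" "h \<in> power_products x j"
  shows "h \<in> carrier G"
proof (rule conjugates_carrier(2))
  show "conjugates \<one> h h"
    by (rule power_products_fixed[OF _ _ assms(2)]) (simp_all add: conjugates_def assms(1))
qed

text \<open>
  Suppose \<open>x\<^sub>j\<^sup>a h = x\<^sub>j\<^sup>b h'\<close> with \<open>a < b \<le> 2\<close> and \<open>h, h'\<close> products of earlier powers, so that
  \<open>h = x\<^sub>j\<^sup>d h'\<close> with \<open>d = b - a\<close>. Conjugation by an element that exchanges \<open>x\<^sub>j\<close> and \<open>x\<^sub>j\<^sub>+\<^sub>1\<close> fixes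
  \<open>h\<close> and \<open>h'\<close>, so \<open>x\<^sub>j\<^sup>d = x\<^sub>j\<^sub>+\<^sub>1\<^sup>d\<close>. The exchange needs a member beyond the last
  factor, so at most \<open>k - 1\<close> members can take part in the products.
\<close>

lemma card_power_products:
  assumes x: "symmetric_family k x" and "j < k"
    and distinct: "\<And>i l d. i < k \<Longrightarrow> l < k \<Longrightarrow> i \<noteq> l \<Longrightarrow> d \<in> {1, 2::nat} \<Longrightarrow>
      x i [^] d \<noteq> x l [^] d"
  shows "card (power_products x j) = 3 ^ j"
  using \<open>j < k\<close>
proof (induction j)
  case (Suc j)
  have carr: "x i \<in> carrier G" if "i < k" for i
    using symmetric_family_carrier[OF x that] .
  have H: "h \<in> carrier G" if "h \<in> power_products x j" for h
    using power_products_carrier[OF _ that] carr Suc.prems by auto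
  obtain g where g: "g \<in> carrier G"
    "\<And>l. l < k \<Longrightarrow> conjugates g (x l) (x (Transposition.transpose j (Suc j) l))"
    using symmetric_family_swap[OF x, of j "Suc j"] Suc.prems by auto
  have fixed: "conjugates g h h" if "h \<in> power_products x j" for h
  proof (rule power_products_fixed[OF g(1) _ that])
    show "conjugates g (x i) (x i)" if "i < j" for i
      using g(2)[of i] that Suc.prems by simp
  qed
  have moved: "conjugates g (x j) (x (Suc j))"
    using g(2)[of j] Suc.prems by simp
  have no_less: False if ab: "a < b" "b < 3" and h: "h \<in> power_products x j"
    and h': "h' \<in> power_products x j" and eq: "x j [^] a \<otimes> h = x j [^] b \<otimes> h'" for a b :: nat and h h'
  proof -
    have xj: "x j \<in> carrier G" and xj': "x (Suc j) \<in> carrier G" using carr Suc.prems by auto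
    have "x j [^] a \<otimes> h = x j [^] a \<otimes> (x j [^] (b - a) \<otimes> h')"
      using eq ab xj H[OF h'] by (simp add: m_assoc[symmetric] nat_pow_mult)
    then have h_eq: "h = x j [^] (b - a) \<otimes> h'"
      using xj H[OF h] H[OF h'] by simp
    have "conjugates g (x j [^] (b - a) \<otimes> h') (x (Suc j) [^] (b - a) \<otimes> h')"
      by (intro conjugates_mult conjugates_pow moved fixed[OF h'])
    then have "h = x (Suc j) [^] (b - a) \<otimes> h'"
      using fixed[OF h] conjugates_right_unique unfolding h_eq[symmetric] by blast
    then have "x j [^] (b - a) = x (Suc j) [^] (b - a)"
      using h_eq xj xj' H[OF h'] by simp
    moreover have "b - a \<in> {1, 2}" using ab by auto
    ultimately show False using distinct[of j "Suc j"] Suc.prems by auto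
  qed
  have "inj_on (\<lambda>(a::nat, h). x j [^] a \<otimes> h) ({..<3} \<times> power_products x j)"
  proof (rule inj_onI, clarify)
    fix a b :: nat and h h'
    assume *: "a < 3" "b < 3" "h \<in> power_products x j" "h' \<in> power_products x j"
      "x j [^] a \<otimes> h = x j [^] b \<otimes> h'"
    have "\<not> a < b" "\<not> b < a"
      using no_less[OF _ *(2,3,4,5)] no_less[OF _ *(1,4,3) *(5)[symmetric]] by blast+
    then have "a = b" by simp
    moreover have "x j \<in> carrier G" using carr Suc.prems by simp
    ultimately show "a = b \<and> h = h'" using *(5) H[OF *(3)] H[OF *(4)] by simp
  qed
  then show ?case using Suc by (simp add: card_image card_cartesian_product)
qed simp

lemma commuting_symmetric_family_card:
  assumes x: "symmetric_family k x" and "0 < k" and fin: "finite (carrier G)"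
    and commute: "\<And>i j. i < k \<Longrightarrow> j < k \<Longrightarrow> conjugates (x i) (x j) (x j)"
    and distinct: "\<And>i l d. i < k \<Longrightarrow> l < k \<Longrightarrow> i \<noteq> l \<Longrightarrow> d \<in> {1, 2::nat} \<Longrightarrow>
      x i [^] d \<noteq> x l [^] d"
  shows "3 ^ (k - 1) * fact k \<le> order G"
proof -
  have carr: "x i \<in> carrier G" if "i < k" for i
    using symmetric_family_carrier[OF x that] .
  have inj: "inj_on x {..<k}"
  proof (rule inj_onI, rule ccontr)
    fix i l assume "i \<in> {..<k}" "l \<in> {..<k}" "x i = x l" "i \<noteq> l"
    then show False using distinct[of i l 1] by simp
  qed
  let ?C = "power_products x (k - 1)"
  have "fact k * card ?C \<le> order G"
  proof (rule symmetric_family_card[OF x inj fin])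
    show "c \<in> carrier G" if "c \<in> ?C" for c
      by (rule power_products_carrier[OF _ that]) (auto intro: carr)
    show "conjugates c (x i) (x i)" if "c \<in> ?C" "i < k" for c i
      by (rule commutes_sym, rule power_products_fixed[OF _ _ that(1)])
        (use commute carr that(2) in auto)
  qed
  moreover have "card ?C = 3 ^ (k - 1)"
    using \<open>0 < k\<close> by (intro card_power_products[OF x _ distinct]) auto
  ultimately show ?thesis by (simp add: mult.commute)
qed

end

section \<open>Elements satisfying the braid relations\<close>

text \<open>
  The indices start at \<open>0\<close>, so \<open>s i\<close> stands for the image of \<open>\<sigma>\<^sub>i\<^sub>+\<^sub>1\<close> and \<open>m = n - 1\<close>.
\<close>

locale braid_elements = group G for G (structure) +
  fixes m :: nat and s :: "nat \<Rightarrow> 'a"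
  assumes s_carrier: "i < m \<Longrightarrow> s i \<in> carrier G"
    and braid: "Suc i < m \<Longrightarrow> s i \<otimes> s (Suc i) \<otimes> s i = s (Suc i) \<otimes> s i \<otimes> s (Suc i)"
    and far: "Suc i < j \<Longrightarrow> j < m \<Longrightarrow> s i \<otimes> s j = s j \<otimes> s i"
begin

lemma far_commute:
  assumes "i < m" "j < m" "i \<noteq> Suc j" "j \<noteq> Suc i"
  shows "conjugates (s i) (s j) (s j)"
proof -
  consider "i = j" | "Suc i < j" | "Suc j < i" using assms by linarith
  then show ?thesis
    using assms s_carrier far[of i j] far[of j i] by cases (auto simp: conjugates_def)
qed

lemma braid_up:
  assumes "Suc i < m"
  shows "conjugates (s i \<otimes> s (Suc i)) (s i) (s (Suc i))"
  using assms s_carrier[of i] s_carrier[of "Suc i"] braid[OF assms]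
  by (auto simp: conjugates_def m_assoc[symmetric])

lemma braid_down:
  assumes "Suc i < m"
  shows "conjugates (s (Suc i) \<otimes> s i) (s (Suc i)) (s i)"
  using assms s_carrier[of i] s_carrier[of "Suc i"] braid[OF assms]
  by (auto simp: conjugates_def m_assoc[symmetric])

lemma neighbours_eq:
  assumes i: "Suc i < m" and "conjugates (s i) (s (Suc i)) (s (Suc i))"
  shows "s i = s (Suc i)"
proof -
  have carr: "s i \<in> carrier G" "s (Suc i) \<in> carrier G" using i s_carrier by auto
  have "s (Suc i) \<otimes> s i \<otimes> s i = s (Suc i) \<otimes> s i \<otimes> s (Suc i)"
    using assms braid[OF i] by (simp add: conjugates_def)
  then show ?thesis using carr by simp
qed

lemma all_eq_if_first_eq:
  assumes "s 0 = s 1" "i < m"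
  shows "s i = s 0"
proof -
  have step: "s j = s (Suc j)" if "Suc j < m" for j
    using that
  proof (induction j)
    case 0
    then show ?case using assms by simp
  next
    case (Suc j)
    have "conjugates (s j) (s (Suc (Suc j))) (s (Suc (Suc j)))"
      using Suc.prems by (intro far_commute) auto
    then show ?case using neighbours_eq[OF Suc.prems] Suc by simp
  qed
  show ?thesis using \<open>i < m\<close> by (induction i) (use step in auto)
qed

text \<open>
  The fourth element commutes with the first, hence with the third once these two agree; commuting
  neighbours are equal, so the third equals the fourth, and the same argument makes the second
  equal to the third.
\<close>

lemma first_eq_if_skip_eq:
  assumes "4 \<le> m" "s 0 = s 2"
  shows "s 0 = s 1"
proof -
  have "conjugates (s 0) (s 3) (s 3)" using assms by (intro far_commute) auto
  then have "s 2 = s 3"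
    using neighbours_eq[of 2] assms by (simp add: numeral_2_eq_2 numeral_3_eq_3)
  moreover have "conjugates (s 1) (s 3) (s 3)" using assms by (intro far_commute) auto
  ultimately have "s 1 = s 2"
    using neighbours_eq[of 1] assms by (simp add: numeral_2_eq_2)
  then show ?thesis using assms by simp
qed

text \<open>
  For consecutive \<open>a, b, c\<close> the element \<open>b c a b\<close> lets two neighbouring strands cross over the next two,
  so it exchanges \<open>a\<close> and \<open>c\<close>. It does not touch the strands of the other members.
\<close>

lemma alternate_symmetric:
  assumes "2 * k \<le> Suc m"
  shows "symmetric_family k (\<lambda>i. s (2 * i))"
proof (rule symmetric_familyI)
  show "s (2 * i) \<in> carrier G" if "i < k" for i using that assms s_carrier by auto
  fix i assume i: "Suc i < k"
  let ?a = "s (2 * i)" and ?b = "s (Suc (2 * i))" and ?c = "s (Suc (Suc (2 * i)))"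
  have m: "Suc (Suc (2 * i)) < m" using i assms by simp
  have carr: "?a \<in> carrier G" "?b \<in> carrier G" "?c \<in> carrier G" using m s_carrier by auto
  have ac: "?a \<otimes> ?c = ?c \<otimes> ?a" using far m by auto
  let ?g = "(?b \<otimes> ?c) \<otimes> (?a \<otimes> ?b)"
  have "?g = ?b \<otimes> (?c \<otimes> ?a) \<otimes> ?b" using carr by (simp add: m_assoc)
  also have "\<dots> = ?b \<otimes> (?a \<otimes> ?c) \<otimes> ?b" using ac by simp
  also have "\<dots> = (?b \<otimes> ?a) \<otimes> (?c \<otimes> ?b)" using carr by (simp add: m_assoc)
  finally have g': "?g = (?b \<otimes> ?a) \<otimes> (?c \<otimes> ?b)" .
  have up: "conjugates ?g ?a ?c"
    using conjugates_comp[OF braid_up braid_up] m by auto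
  have down: "conjugates ?g ?c ?a"
    unfolding g' using conjugates_comp[OF braid_down braid_down] m by auto
  have other: "conjugates ?g (s (2 * l)) (s (2 * l))" if "l < k" "l \<noteq> i" "l \<noteq> Suc i" for l
  proof -
    have "2 * l \<noteq> Suc (2 * i)" "2 * l \<noteq> Suc (Suc (Suc (2 * i)))" by presburger+
    then show ?thesis
      using that m assms by (intro conjugates_comp[of _ "s (2 * l)"] far_commute) auto
  qed
  show "\<exists>g \<in> carrier G. \<forall>l<k. conjugates g (s (2 * l))
      (s (2 * Transposition.transpose i (Suc i) l))"
  proof (intro bexI allI impI)
    show "?g \<in> carrier G" using carr by simp
    show "conjugates ?g (s (2 * l)) (s (2 * Transposition.transpose i (Suc i) l))" if "l < k" for l
      using up down other[OF that] by (cases "l = i"; cases "l = Suc i") auto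
  qed
qed

text \<open>
  Write \<open>q\<close> for the square of \<open>s 0\<close>. Like \<open>s 0\<close>, it commutes
  with every \<open>s j\<close> except possibly \<open>s 1\<close>. The element
  \<open>s 2 s 3\<close> fixes \<open>s 0\<close> and takes \<open>s 2\<close> to \<open>s 3\<close>, so \<open>q\<close> is also the square of \<open>s 3\<close>, which commutes
  with \<open>s 1\<close>. Thus \<open>q\<close> commutes with all of them, and it equals their squares since they are conjugate.
\<close>

lemma squares_central:
  assumes "4 \<le> m" and eq: "s 0 [^] (2::nat) = s 2 [^] (2::nat)" and ij: "i < m" "j < m"
  shows "conjugates (s j) (s i [^] (2::nat)) (s i [^] (2::nat))"
proof -
  have "conjugates (s 2 \<otimes> s 3) (s 2 [^] (2::nat)) (s 3 [^] (2::nat))"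
    using conjugates_pow[OF braid_up[of 2]] assms by simp
  moreover have "conjugates (s 2 \<otimes> s 3) (s 0 [^] (2::nat)) (s 0 [^] (2::nat))"
    using assms by (intro conjugates_comp[of _ "s 0 [^] (2::nat)"] conjugates_pow far_commute) auto
  ultimately have eq3: "s 0 [^] (2::nat) = s 3 [^] (2::nat)"
    using conjugates_right_unique eq by simp
  have base: "conjugates (s j) (s 0 [^] (2::nat)) (s 0 [^] (2::nat))" if "j < m" for j
  proof (cases "j = 1")
    case True
    have "conjugates (s 1) (s 3 [^] (2::nat)) (s 3 [^] (2::nat))"
      using assms by (intro conjugates_pow far_commute) auto
    then show ?thesis using eq3 True by simp
  next
    case False
    then show ?thesis using that by (intro conjugates_pow far_commute) auto
  qed
  have "s i [^] (2::nat) = s 0 [^] (2::nat)"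
    using ij(1)
  proof (induction i)
    case (Suc i)
    have "conjugates (s i \<otimes> s (Suc i)) (s i [^] (2::nat)) (s (Suc i) [^] (2::nat))"
      using conjugates_pow[OF braid_up] Suc.prems by blast
    moreover have "conjugates (s i \<otimes> s (Suc i)) (s 0 [^] (2::nat)) (s 0 [^] (2::nat))"
      using base Suc.prems by (intro conjugates_comp) auto
    ultimately show ?case using Suc conjugates_right_unique by simp
  qed simp
  then show ?thesis using base ij by simp
qed

text \<open>
  If the \<open>s i\<close> are the neighbouring transpositions of a symmetric group, these are the
  transpositions \<open>(1 2), (1 3), (1 4), \<dots>\<close>.
\<close>

primrec star :: "nat \<Rightarrow> 'a" where
  "star 0 = s 0"
| "star (Suc i) = s (Suc i) \<otimes> star i \<otimes> inv (s (Suc i))"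

lemma star_carrier: "i < m \<Longrightarrow> star i \<in> carrier G"
  by (induction i) (auto simp: s_carrier)

lemma star_up: "Suc i < m \<Longrightarrow> conjugates (s (Suc i)) (star i) (star (Suc i))"
  using s_carrier[of "Suc i"] star_carrier[of i] by (simp add: conjugates_def m_assoc)

lemma star_fixed_above:
  assumes "Suc i < j" "j < m"
  shows "conjugates (s j) (star i) (star i)"
  using assms
proof (induction i)
  case 0
  then show ?case using far_commute by simp
next
  case (Suc i)
  have "conjugates (s j) (s (Suc i)) (s (Suc i))" using Suc.prems by (intro far_commute) auto
  then show ?case using Suc
    by (auto intro!: conjugates_mult conjugates_fixed_inv)
qed

text \<open>
  In the base case, \<open>b a\<close> takes \<open>star j\<close> to \<open>star (j + 2)\<close>, where \<open>a = s (j + 1)\<close> and \<open>b = s (j + 2)\<close>.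
  Since \<open>b\<close> fixes \<open>star j\<close>, the product \<open>b a b = a b a\<close> takes it there too, and comparing the two shows that \<open>a\<close> fixes
  \<open>star (j + 2)\<close>. Later members arise by conjugating with elements that commute with \<open>a\<close>.
\<close>

lemma star_fixed_below:
  assumes "Suc j < i" "i < m"
  shows "conjugates (s (Suc j)) (star i) (star i)"
proof -
  have "conjugates (s (Suc j)) (star (Suc (Suc j) + d)) (star (Suc (Suc j) + d))"
    if "Suc (Suc j) + d < m" for d
    using that
  proof (induction d)
    case 0
    let ?a = "s (Suc j)" and ?b = "s (Suc (Suc j))"
    have m: "Suc (Suc j) < m" using 0 by simp
    have carr: "?a \<in> carrier G" "?b \<in> carrier G" using m s_carrier by auto
    have up: "conjugates (?b \<otimes> ?a) (star j) (star (Suc (Suc j)))"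
      using conjugates_comp[OF star_up star_up] m by auto
    have "conjugates ((?b \<otimes> ?a) \<otimes> ?b) (star j) (star (Suc (Suc j)))"
      using conjugates_comp[OF up star_fixed_above] m by auto
    then have "conjugates (?a \<otimes> (?b \<otimes> ?a)) (star j) (star (Suc (Suc j)))"
      using braid[OF m] carr by (simp add: m_assoc)
    then show ?case using conjugates_left_factor[OF up _ carr(1)] by simp
  next
    case (Suc d)
    let ?i = "Suc (Suc j) + d"
    have "conjugates (s (Suc j)) (s (Suc ?i)) (s (Suc ?i))"
      using Suc.prems by (intro far_commute) auto
    moreover from this have "conjugates (s (Suc j)) (inv s (Suc ?i)) (inv s (Suc ?i))"
      by (rule conjugates_fixed_inv)
    ultimately show ?case using Suc by (auto intro!: conjugates_mult)
  qed
  moreover have "Suc (Suc j) + (i - Suc (Suc j)) = i" using assms by simp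
  ultimately show ?thesis using assms(2) by metis
qed

text \<open>
  Conjugation by \<open>s (i + 1)\<close> takes \<open>star i\<close> to \<open>star (i + 1)\<close> by construction. Doing it again has
  to lead back to \<open>star i\<close>, and does so because the square of \<open>s (i + 1)\<close> is central.
\<close>

lemma star_symmetric:
  assumes central: "\<And>i j. i < m \<Longrightarrow> j < m \<Longrightarrow>
      conjugates (s j) (s i [^] (2::nat)) (s i [^] (2::nat))"
  shows "symmetric_family m star"
proof (rule symmetric_familyI)
  show "star i \<in> carrier G" if "i < m" for i using star_carrier[OF that] .
  fix i assume i: "Suc i < m"
  have carr: "s (Suc i) \<in> carrier G" using i s_carrier by auto
  have "conjugates (s (Suc i) [^] (2::nat)) (star l) (star l)" if "l < m" for l
    using that
  proof (induction l)
    case 0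
    then show ?case using commutes_sym[OF central] i by simp
  next
    case (Suc l)
    have "conjugates (s (Suc i) [^] (2::nat)) (s (Suc l)) (s (Suc l))"
      using commutes_sym[OF central] i Suc.prems by simp
    then show ?case using Suc
      by (auto intro!: conjugates_mult conjugates_fixed_inv)
  qed
  from this[of i] have "conjugates (s (Suc i) \<otimes> s (Suc i)) (star i) (star i)"
    using i carr by (simp add: numeral_2_eq_2)
  then have down: "conjugates (s (Suc i)) (star (Suc i)) (star i)"
    by (rule conjugates_left_factor[OF star_up[OF i] _ carr])
  show "\<exists>g \<in> carrier G. \<forall>l<m. conjugates g (star l)
      (star (Transposition.transpose i (Suc i) l))"
  proof (intro bexI allI impI)
    show "s (Suc i) \<in> carrier G" by (rule carr)
    fix l assume l: "l < m"
    consider "l = i" | "l = Suc i" | "l < i" | "Suc i < l" by linarith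
    then show "conjugates (s (Suc i)) (star l) (star (Transposition.transpose i (Suc i) l))"
    proof cases
      case 1
      then show ?thesis using star_up[OF i] by simp
    next
      case 2
      then show ?thesis using down by simp
    next
      case 3
      then show ?thesis using star_fixed_above[of l "Suc i"] i by simp
    next
      case 4
      then show ?thesis using star_fixed_below[of i l] l by simp
    qed
  qed
qed

lemma order_bound:
  assumes "4 \<le> m" and fin: "finite (carrier G)" and neq: "s 0 \<noteq> s 1"
    and k: "2 \<le> k" "2 * k \<le> Suc m"
  shows "3 ^ (k - 1) * fact k \<le> order G"
proof (cases "s 0 [^] (2::nat) = s 2 [^] (2::nat)")
  case False
  let ?x = "\<lambda>i. s (2 * i)"
  have sym: "symmetric_family k ?x" by (rule alternate_symmetric[OF k(2)])
  have carr: "s 0 \<in> carrier G" "s 2 \<in> carrier G" using assms s_carrier by auto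
  show ?thesis
  proof (rule commuting_symmetric_family_card[OF sym _ fin])
    show "0 < k" using k by simp
    show "conjugates (?x i) (?x j) (?x j)" if "i < k" "j < k" for i j
    proof -
      have "2 * i \<noteq> Suc (2 * j)" "2 * j \<noteq> Suc (2 * i)" by presburger+
      then show ?thesis using that k by (intro far_commute) auto
    qed
    show "?x i [^] d \<noteq> ?x l [^] d" if "i < k" "l < k" "i \<noteq> l" "d \<in> {1, 2}" for i l and d :: nat
    proof
      assume "?x i [^] d = ?x l [^] d"
      then have "s 0 [^] d = s 2 [^] d"
        using symmetric_family_pow_eq[OF sym that(1-3), of d 0 1] k by simp
      moreover have "s 0 \<noteq> s 2" using first_eq_if_skip_eq assms by blast
      ultimately show False using that(4) False carr by auto
    qed
  qed
next
  case True
  have sym: "symmetric_family m star"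
    using star_symmetric squares_central[OF assms(1) True] by blast
  have "star 0 \<noteq> star 1"
  proof
    assume "star 0 = star 1"
    then have "conjugates (s 1) (s 0) (s 0)"
      using star_up[of 0] assms by simp
    then show False using neighbours_eq[of 0] commutes_sym neq assms by simp
  qed
  then have "inj_on star {..<m}"
    using symmetric_family_inj_on[OF sym, of 0 1] assms by simp
  then have "fact m * card {\<one>} \<le> order G"
    by (rule symmetric_family_card[OF sym _ fin])
      (auto intro: commutes_sym conjugates_one star_carrier)
  \<comment> \<open>Each factor \<open>k + 1, \<dots>, k + j\<close> is at least \<open>3\<close> because \<open>k \<ge> 2\<close>.\<close>
  moreover have "3 ^ j * fact k \<le> (fact (k + j) :: nat)" for j
  proof (induction j)
    case (Suc j)
    have "3 * (3 ^ j * fact k) \<le> Suc (k + j) * fact (k + j)"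
      using Suc k by (intro mult_mono) auto
    then show ?case by (simp add: mult.assoc)
  qed simp
  moreover have "fact (k + (k - 1)) \<le> (fact m :: nat)"
    using k by (intro fact_mono) auto
  ultimately show ?thesis by (metis card.empty card_insert_disjoint empty_iff finite.emptyI
      le_trans mult.right_neutral One_nat_def)
qed

end

section \<open>Quotients of the braid group\<close>

definition presented_gen :: "'x set \<Rightarrow> ('x word \<times> 'x word) set \<Rightarrow> 'x \<Rightarrow> 'x word set" where
  "presented_gen X R x = pres_rel X R `` {[(x, True)]}"

lemma singleton_words: "x \<in> X \<Longrightarrow> [(x, b)] \<in> words X"
  by (simp add: words_def)

lemma class_carrier: "u \<in> words X \<Longrightarrow> pres_rel X R `` {u} \<in> carrier (presented_group X R)"
  by (simp add: presented_group_def quotientI)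

lemma presented_gen_carrier: "x \<in> X \<Longrightarrow> presented_gen X R x \<in> carrier (presented_group X R)"
  unfolding presented_gen_def by (intro class_carrier singleton_words)

lemma class_inverse_letter:
  assumes "x \<in> X"
  shows "pres_rel X R `` {[(x, False)]} = inv\<^bsub>presented_group X R\<^esub> presented_gen X R x"
proof -
  interpret P: group "presented_group X R" by (rule group_presented_group)
  have w: "[(x, False)] \<in> words X" "[(x, True)] \<in> words X"
    using assms by (auto intro: singleton_words)
  have "pres_rel X R `` {[(x, False)]} \<otimes>\<^bsub>presented_group X R\<^esub> presented_gen X R x
      = pres_rel X R `` {[(x, False), (x, True)]}"
    using presented_group_mult[OF w] by (simp add: presented_gen_def)
  also have "\<dots> = \<one>\<^bsub>presented_group X R\<^esub>"
    using equiv_class_eq[OF equiv_pres_rel pres_rel.cancel[OF assms, of False R]]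
    by (simp add: presented_group_def)
  finally show ?thesis
    by (intro P.inv_equality[symmetric] class_carrier[OF w(1)] presented_gen_carrier[OF assms])
qed

text \<open>
  The centralizer of \<open>z\<close> is a subgroup, and the classes of the letters generate the presented group.
\<close>

lemma presented_hom_centralizer:
  fixes G (structure)
  assumes "group G" and f: "f \<in> hom (presented_group X R) G" and z: "z \<in> carrier G"
    and gens: "\<And>x. x \<in> X \<Longrightarrow> group.conjugates G (f (presented_gen X R x)) z z"
    and A: "A \<in> carrier (presented_group X R)"
  shows "group.conjugates G (f A) z z"
proof -
  interpret group G by fact
  interpret P: group "presented_group X R" by (rule group_presented_group)
  interpret f: group_hom "presented_group X R" G f
    by unfold_locales (rule f)
  have "conjugates (f (pres_rel X R `` {u})) z z" if "u \<in> words X" for u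
    using that
  proof (induction u)
    case Nil
    have "f (pres_rel X R `` {[]}) = \<one>"
      using f.hom_one by (simp add: presented_group_def)
    then show ?case using z by (simp add: conjugates_def)
  next
    case (Cons a u)
    obtain x b where a: "a = (x, b)" by fastforce
    have x: "x \<in> X" and u: "u \<in> words X" and ax: "[a] \<in> words X"
      using Cons.prems by (auto simp: words_def a)
    have "conjugates (f (pres_rel X R `` {[a]})) z z"
    proof (cases b)
      case True
      then show ?thesis using gens[OF x] by (simp add: a presented_gen_def)
    next
      case False
      have "f (pres_rel X R `` {[a]}) = inv f (presented_gen X R x)"
        using f.hom_inv[OF presented_gen_carrier[OF x]] False
        by (simp add: a class_inverse_letter[OF x])
      then show ?thesis using conjugates_inv[OF gens[OF x]] by simp
    qed
    moreover have "f (pres_rel X R `` {a # u}) = f (pres_rel X R `` {[a]}) \<otimes> f (pres_rel X R `` {u})"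
      using f.hom_mult[OF class_carrier[OF ax] class_carrier[OF u]]
      by (simp add: presented_group_mult[OF ax u])
    ultimately show ?case using conjugates_comp Cons.IH[OF u] by simp
  qed
  moreover obtain u where "u \<in> words X" "A = pres_rel X R `` {u}"
    using A by (auto simp: presented_group_def elim: quotientE)
  ultimately show ?thesis by simp
qed

lemma presented_class_eq:
  assumes "(u, v) \<in> R" "u \<in> words X" "v \<in> words X"
  shows "pres_rel X R `` {u} = pres_rel X R `` {v}"
  by (intro equiv_class_eq[OF equiv_pres_rel] pres_rel.relation assms)

lemma presented_gen_mult:
  assumes "x \<in> X" "u \<in> words X"
  shows "presented_gen X R x \<otimes>\<^bsub>presented_group X R\<^esub> pres_rel X R `` {u}
    = pres_rel X R `` {(x, True) # u}"
  unfolding presented_gen_def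
  using presented_group_mult[OF singleton_words[OF assms(1)] assms(2)] by simp

text \<open>A homomorphism into an abelian group kills all commutators.\<close>

lemma hom_to_comm_group_factors:
  assumes "group H" "comm_group G" and f: "f \<in> hom H G"
  shows "factors_through_abelianization H G f"
proof -
  interpret H: group H by fact
  interpret G: comm_group G by fact
  interpret f: group_hom H G f by unfold_locales (rule f)
  let ?D = "derived H (carrier H)"
  have "f ` ?D = derived G (f ` carrier H)" using f.derived_img[of "carrier H"] by simp
  also have "\<dots> = {\<one>\<^bsub>G\<^esub>}" by (rule G.derived_eq_singleton) auto
  finally have "f ` ?D = {\<one>\<^bsub>G\<^esub>}" .
  then have "?D \<subseteq> kernel H G f"
    using H.derived_in_carrier[of "carrier H"] by (auto simp: kernel_def)
  then obtain h where "h \<in> hom (H Mod ?D) G" "\<And>x. x \<in> carrier H \<Longrightarrow> h (?D #>\<^bsub>H\<^esub> x) = f x"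
    using f.FactGroup_universal_kernel[OF H.derived_self_is_normal] by blast
  then show ?thesis unfolding factors_through_abelianization_def abelianization_def
    by (intro bexI[of _ h]) simp_all
qed

lemma braid_gen_elements:
  fixes n :: nat and G (structure)
  defines "\<sigma> \<equiv> \<lambda>i. presented_gen {1..<n} (braid_relations n) (Suc i)"
  assumes "group G" and f: "f \<in> hom (braid_group n) G"
  shows "braid_elements G (n - 1) (\<lambda>i. f (\<sigma> i))"
proof -
  let ?X = "{1..<n}" and ?R = "braid_relations n"
  interpret group G by fact
  interpret B: group "braid_group n" by (rule group_braid_group)
  interpret f: group_hom "braid_group n" G f by unfold_locales (rule f)
  have carr: "\<sigma> i \<in> carrier (braid_group n)" if "i < n - 1" for i
    unfolding \<sigma>_def braid_group_def using that by (intro presented_gen_carrier) auto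
  have word2: "\<sigma> i \<otimes>\<^bsub>braid_group n\<^esub> \<sigma> j = pres_rel ?X ?R `` {[(Suc i, True), (Suc j, True)]}"
    if "i < n - 1" "j < n - 1" for i j
    using that presented_gen_mult[of "Suc i" ?X "[(Suc j, True)]" ?R]
      singleton_words[of "Suc j" ?X True]
    by (auto simp: \<sigma>_def braid_group_def presented_gen_def[of _ _ "Suc j"])
  have word3: "\<sigma> i \<otimes>\<^bsub>braid_group n\<^esub> \<sigma> j \<otimes>\<^bsub>braid_group n\<^esub> \<sigma> l
      = pres_rel ?X ?R `` {[(Suc i, True), (Suc j, True), (Suc l, True)]}"
    if "i < n - 1" "j < n - 1" "l < n - 1" for i j l
  proof -
    have "\<sigma> i \<otimes>\<^bsub>braid_group n\<^esub> (\<sigma> j \<otimes>\<^bsub>braid_group n\<^esub> \<sigma> l)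
      = pres_rel ?X ?R `` {[(Suc i, True), (Suc j, True), (Suc l, True)]}"
      unfolding word2[OF that(2,3)]
      unfolding \<sigma>_def braid_group_def
      by (rule presented_gen_mult) (use that in \<open>auto simp: words_def\<close>)
    then show ?thesis using that carr by (simp add: B.m_assoc)
  qed
  show ?thesis
  proof unfold_locales
    show "f (\<sigma> i) \<in> carrier G" if "i < n - 1" for i
      using carr[OF that] by simp
    show "f (\<sigma> i) \<otimes> f (\<sigma> (Suc i)) \<otimes> f (\<sigma> i) = f (\<sigma> (Suc i)) \<otimes> f (\<sigma> i) \<otimes> f (\<sigma> (Suc i))"
      if i: "Suc i < n - 1" for i
    proof -
      have "\<sigma> i \<otimes>\<^bsub>braid_group n\<^esub> \<sigma> (Suc i) \<otimes>\<^bsub>braid_group n\<^esub> \<sigma> i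
        = \<sigma> (Suc i) \<otimes>\<^bsub>braid_group n\<^esub> \<sigma> i \<otimes>\<^bsub>braid_group n\<^esub> \<sigma> (Suc i)"
        using i by (simp add: word3)
          (rule presented_class_eq; force simp: braid_relations_def words_def)
      then have "f (\<sigma> i \<otimes>\<^bsub>braid_group n\<^esub> \<sigma> (Suc i) \<otimes>\<^bsub>braid_group n\<^esub> \<sigma> i)
        = f (\<sigma> (Suc i) \<otimes>\<^bsub>braid_group n\<^esub> \<sigma> i \<otimes>\<^bsub>braid_group n\<^esub> \<sigma> (Suc i))" by simp
      then show ?thesis using i carr by simp
    qed
    show "f (\<sigma> i) \<otimes> f (\<sigma> j) = f (\<sigma> j) \<otimes> f (\<sigma> i)" if ij: "Suc i < j" "j < n - 1" for i j
    proof -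
      have "\<sigma> i \<otimes>\<^bsub>braid_group n\<^esub> \<sigma> j = \<sigma> j \<otimes>\<^bsub>braid_group n\<^esub> \<sigma> i"
        using ij by (simp add: word2)
          (rule presented_class_eq; force simp: braid_relations_def words_def)
      then have "f (\<sigma> i \<otimes>\<^bsub>braid_group n\<^esub> \<sigma> j) = f (\<sigma> j \<otimes>\<^bsub>braid_group n\<^esub> \<sigma> i)" by simp
      then show ?thesis using ij carr by simp
    qed
  qed
qed

text \<open>
  The image is generated by the single element \<open>c\<close>, hence abelian.
\<close>

lemma cyclic_if_gens_eq:
  fixes n :: nat
  defines "\<sigma> \<equiv> \<lambda>i. presented_gen {1..<n} (braid_relations n) (Suc i)"
  assumes "group G" and f: "f \<in> epi (braid_group n) G"
    and eq: "\<And>i. i < n - 1 \<Longrightarrow> f (\<sigma> i) = c"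
  shows "cyclic_braid_hom n G f"
proof -
  interpret group G by fact
  have hom: "f \<in> hom (braid_group n) G" and onto: "f ` carrier (braid_group n) = carrier G"
    using f by (auto simp: epi_def)
  interpret E: braid_elements G "n - 1" "\<lambda>i. f (\<sigma> i)"
    unfolding \<sigma>_def using braid_gen_elements[OF \<open>group G\<close> hom] .
  have gen: "f (presented_gen {1..<n} (braid_relations n) x) = c" "c \<in> carrier G"
    if "x \<in> {1..<n}" for x
    using eq[of "x - 1"] E.s_carrier[of "x - 1"] that by (auto simp: \<sigma>_def)
  have centralizes: "conjugates g z z"
    if z: "z \<in> carrier G" "g \<in> carrier G" "\<And>x. x \<in> {1..<n} \<Longrightarrow> conjugates c z z" for z g
  proof -
    obtain A where A: "A \<in> carrier (braid_group n)" "g = f A" using z(2) onto by blast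
    show ?thesis
      unfolding A(2)
    proof (rule presented_hom_centralizer[OF \<open>group G\<close> hom[unfolded braid_group_def] z(1)])
      show "conjugates (f (presented_gen {1..<n} (braid_relations n) x)) z z"
        if "x \<in> {1..<n}" for x
        unfolding gen(1)[OF that] by (rule z(3)[OF that])
      show "A \<in> carrier (presented_group {1..<n} (braid_relations n))"
        using A(1) unfolding braid_group_def .
    qed
  qed
  \<comment> \<open>Applied to \<open>c\<close> itself, this makes \<open>c\<close> central; applied again, it makes every element central.\<close>
  have central: "conjugates c h h" if "h \<in> carrier G" "x \<in> {1..<n}" for h x
    by (rule commutes_sym, rule centralizes) (use that gen(2) commutes_refl in blast)+
  have "conjugates g h h" if "g \<in> carrier G" "h \<in> carrier G" for g h
    by (rule centralizes[OF that(2,1) central[OF that(2)]])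
  then have "comm_group G"
    by (intro group_comm_groupI) (simp add: conjugates_def)
  then show ?thesis
    using hom_to_comm_group_factors[OF group_braid_group _ hom] hom
    by (simp add: cyclic_braid_hom_def)
qed

theorem theorem4:
  fixes n :: nat and G :: "('g, 'k) monoid_scheme"
  assumes "n \<ge> 5" and "noncyclic_braid_quotient n G"
  shows "finite (carrier G) \<longrightarrow> order G \<ge> 3 ^ (n div 2 - 1) * fact (n div 2)"
proof
  assume fin: "finite (carrier G)"
  obtain f where G: "group G" and f: "f \<in> epi (braid_group n) G"
    and noncyclic: "\<not> cyclic_braid_hom n G f"
    using assms(2) by (auto simp: noncyclic_braid_quotient_def)
  let ?s = "\<lambda>i. f (presented_gen {1..<n} (braid_relations n) (Suc i))"
  interpret braid_elements G "n - 1" ?s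
    using braid_gen_elements[OF G] f by (auto simp: epi_def)
  have "?s 0 \<noteq> ?s 1"
    using cyclic_if_gens_eq[OF G f] all_eq_if_first_eq noncyclic by blast
  then show "3 ^ (n div 2 - 1) * fact (n div 2) \<le> order G"
    using assms(1) by (intro order_bound[OF _ fin]) auto
qed

end
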